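(* Let $\sigma$ be a relational signature and let $\varphi(\bar x)$ be a first-order $\sigma$-formula with $|\bar x|>0$ that belongs to $\mathcal{B}\Sigma_{n,\ell}$. Then $\mathrm{lr}(\varphi)<(2\ell+1)^n\le\|\varphi\|^n$.
   Context: Structures are finite with non-empty universe. $\mathcal{B}\Sigma_{0,\ell}$ is the set of quantifier-free first-order formulas; a formula belongs to $\mathcal{B}\Sigma_{n+1,\ell}$ if it is a Boolean combination of formulas $\exists x_1\cdots\exists x_k\,\psi$ with $k\le\ell$ and $\psi\in\mathcal{B}\Sigma_{n,\ell}$. $\|\varphi\|$ is the length of $\varphi$ as a word. The Gaifman graph of $\mathcal{A}$ has vertex set $A$ and an edge between distinct elements occurring together in a tuple of some relation. For a tuple $\bar a$, $N_r^{\mathcal{A}}(\bar a)$ is the set of elements at Gaifman distance $\le r$ from an entry of $\bar a$, and the $r$-sphere of $\bar a$ is the induced substructure on $N_r^{\mathcal{A}}(\bar a)$ with distinguished tuple $\bar a$. $(\mathcal{A},\bar a)$ and $(\mathcal{B},\bar b)$ ($\bar a\in A^k$, $\bar b\in B^k$) are $r$-equivalent if there is a bijection $f:A\to B$ such that for all $c\in A$ the $r$-spheres of $(\bar a,c)$ and $(\bar b,f(c))$ are isomorphic (respecting distinguished tuples). $\varphi(\bar x)$ is Hanf-local if some $r\ge0$ satisfies: whenever $(\mathcal{A},\bar a)$ and $(\mathcal{B},\bar b)$ are $r$-equivalent, $\mathcal{A}\models\varphi[\bar a]\iff\mathcal{B}\models\varphi[\bar b]$; the least such $r$ is $\mathr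m{lr}(\varphi)$.
   Formalization: The inequality (2ℓ+1)^n ≤ ‖φ‖^n is stated only for the least ℓ with φ in BΣ_{n,ℓ}, as it fails for larger ℓ (e.g. ∃x R(x) in BΣ_{1,100}); lr(φ) < (2ℓ+1)^n is stated for every ℓ. Finite structures are taken, up to isomorphism, with universes that are subsets of ℕ. *)

theory Defs
  imports Main
begin

datatype 'r fo =
    Eq nat nat
  | Rel 'r "nat list"
  | Neg "'r fo"
  | Conj "'r fo" "'r fo"
  | Disj "'r fo" "'r fo"
  | Ex nat "'r fo"

fun wf_fo :: "('r \<Rightarrow> nat) \<Rightarrow> 'r fo \<Rightarrow> bool" where
  "wf_fo ar (Eq x y) = True"
| "wf_fo ar (Rel R vs) = (length vs = ar R)"
| "wf_fo ar (Neg f) = wf_fo ar f"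
| "wf_fo ar (Conj f g) = (wf_fo ar f \<and> wf_fo ar g)"
| "wf_fo ar (Disj f g) = (wf_fo ar f \<and> wf_fo ar g)"
| "wf_fo ar (Ex x f) = wf_fo ar f"

fun free_vars :: "'r fo \<Rightarrow> nat set" where
  "free_vars (Eq x y) = {x, y}"
| "free_vars (Rel R vs) = set vs"
| "free_vars (Neg f) = free_vars f"
| "free_vars (Conj f g) = free_vars f \<union> free_vars g"
| "free_vars (Disj f g) = free_vars f \<union> free_vars g"
| "free_vars (Ex x f) = free_vars f - {x}"

text \<open>Length of a formula as a word: an atom R(x1,...,xk) counts its relation
  symbol and its variables, x = y counts three symbols, negation one symbol,
  a binary connective one symbol plus a pair of parentheses, and an
  existential quantifier \<open>\<exists>x\<close> two symbols.\<close>

fun fo_len :: "'r fo \<Rightarrow> nat" where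
  "fo_len (Eq x y) = 3"
| "fo_len (Rel R vs) = 1 + length vs"
| "fo_len (Neg f) = 1 + fo_len f"
| "fo_len (Conj f g) = 3 + fo_len f + fo_len g"
| "fo_len (Disj f g) = 3 + fo_len f + fo_len g"
| "fo_len (Ex x f) = 2 + fo_len f"

fun qfree :: "'r fo \<Rightarrow> bool" where
  "qfree (Eq x y) = True"
| "qfree (Rel R vs) = True"
| "qfree (Neg f) = qfree f"
| "qfree (Conj f g) = (qfree f \<and> qfree g)"
| "qfree (Disj f g) = (qfree f \<and> qfree g)"
| "qfree (Ex x f) = False"

inductive_set bool_comb :: "'r fo set \<Rightarrow> 'r fo set" for S where
  base: "f \<in> S \<Longrightarrow> f \<in> bool_comb S"
| neg: "f \<in> bool_comb S \<Longrightarrow> Neg f \<in> bool_comb S"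
| conj: "f \<in> bool_comb S \<Longrightarrow> g \<in> bool_comb S \<Longrightarrow> Conj f g \<in> bool_comb S"
| disj: "f \<in> bool_comb S \<Longrightarrow> g \<in> bool_comb S \<Longrightarrow> Disj f g \<in> bool_comb S"

definition ex_block :: "nat list \<Rightarrow> 'r fo \<Rightarrow> 'r fo" where
  "ex_block xs f = foldr Ex xs f"

fun BSigma :: "nat \<Rightarrow> nat \<Rightarrow> 'r fo set" where
  "BSigma 0 l = {f. qfree f}"
| "BSigma (Suc n) l =
     bool_comb {ex_block xs g | xs g. length xs \<le> l \<and> g \<in> BSigma n l}"

text \<open>A structure is a pair (universe, interpretation).  Universes are taken
  to be finite subsets of nat; every finite structure is isomorphic to such
  a one, and all notions below are isomorphism invariant.\<close>

type_synonym 'r struc = "nat set \<times> ('r \<Rightarrow> nat list set)"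

definition is_struc :: "('r \<Rightarrow> nat) \<Rightarrow> 'r struc \<Rightarrow> bool" where
  "is_struc ar A \<longleftrightarrow> finite (fst A) \<and> fst A \<noteq> {} \<and>
     (\<forall>R. \<forall>t \<in> snd A R. length t = ar R \<and> set t \<subseteq> fst A)"

fun sat :: "'r struc \<Rightarrow> (nat \<Rightarrow> nat) \<Rightarrow> 'r fo \<Rightarrow> bool" where
  "sat A v (Eq x y) = (v x = v y)"
| "sat A v (Rel R vs) = (map v vs \<in> snd A R)"
| "sat A v (Neg f) = (\<not> sat A v f)"
| "sat A v (Conj f g) = (sat A v f \<and> sat A v g)"
| "sat A v (Disj f g) = (sat A v f \<or> sat A v g)"
| "sat A v (Ex x f) = (\<exists>a \<in> fst A. sat A (v(x := a)) f)"

definition assign :: "nat list \<Rightarrow> nat list \<Rightarrow> nat \<Rightarrow> nat" where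
  "assign xs as y = (case map_of (zip xs as) y of Some a \<Rightarrow> a | None \<Rightarrow> hd as)"

definition gedge :: "'r struc \<Rightarrow> nat \<Rightarrow> nat \<Rightarrow> bool" where
  "gedge A a b \<longleftrightarrow> a \<noteq> b \<and> (\<exists>R. \<exists>t \<in> snd A R. a \<in> set t \<and> b \<in> set t)"

fun gdist_le :: "'r struc \<Rightarrow> nat \<Rightarrow> nat \<Rightarrow> nat \<Rightarrow> bool" where
  "gdist_le A 0 a c = (a = c \<and> a \<in> fst A)"
| "gdist_le A (Suc r) a c = (gdist_le A r a c \<or> (\<exists>d. gdist_le A r a d \<and> gedge A d c))"

definition nbhd :: "'r struc \<Rightarrow> nat \<Rightarrow> nat list \<Rightarrow> nat set" where
  "nbhd A r as = {c \<in> fst A. \<exists>a \<in> set as. gdist_le A r a c}"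

definition sphere_iso :: "'r struc \<Rightarrow> nat list \<Rightarrow> 'r struc \<Rightarrow> nat list \<Rightarrow> nat \<Rightarrow> bool" where
  "sphere_iso A as B bs r \<longleftrightarrow> length as = length bs \<and>
     (\<exists>h. bij_betw h (nbhd A r as) (nbhd B r bs) \<and> map h as = bs \<and>
        (\<forall>R t. set t \<subseteq> nbhd A r as \<longrightarrow> (t \<in> snd A R \<longleftrightarrow> map h t \<in> snd B R)))"

definition r_equiv :: "'r struc \<Rightarrow> nat list \<Rightarrow> 'r struc \<Rightarrow> nat list \<Rightarrow> nat \<Rightarrow> bool" where
  "r_equiv A as B bs r \<longleftrightarrow>
     (\<exists>f. bij_betw f (fst A) (fst B) \<and>
        (\<forall>c \<in> fst A. sphere_iso A (as @ [c]) B (bs @ [f c]) r))"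

definition hanf_local_with :: "('r \<Rightarrow> nat) \<Rightarrow> nat list \<Rightarrow> 'r fo \<Rightarrow> nat \<Rightarrow> bool" where
  "hanf_local_with ar xs f r \<longleftrightarrow>
     (\<forall>A B as bs. is_struc ar A \<and> is_struc ar B \<and>
        length as = length xs \<and> length bs = length xs \<and>
        set as \<subseteq> fst A \<and> set bs \<subseteq> fst B \<and> r_equiv A as B bs r \<longrightarrow>
        (sat A (assign xs as) f \<longleftrightarrow> sat B (assign xs bs) f))"

definition hanf_local :: "('r \<Rightarrow> nat) \<Rightarrow> nat list \<Rightarrow> 'r fo \<Rightarrow> bool" where
  "hanf_local ar xs f \<longleftrightarrow> (\<exists>r. hanf_local_with ar xs f r)"

definition locality_rank :: "('r \<Rightarrow> nat) \<Rightarrow> nat list \<Rightarrow> 'r fo \<Rightarrow> nat" where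
  "locality_rank ar xs f = (LEAST r. hanf_local_with ar xs f r)"

end

theory Submission
  imports Defs
begin

text \<open>If the points named by \<open>D\<close> have isomorphic \<open>((2r+1)k+r)\<close>-spheres in two structures and the single
  elements of the structures correspond under a bijection preserving large spheres, then every
  \<open>r\<close>-sphere type is realised by equally many \<open>k\<close>-tuples over \<open>D\<close> in both. Hence a block of at most \<open>l\<close>
  quantifiers raises the required radius from \<open>r\<close> to \<open>(2r+1)l+r\<close>, so \<open>n\<close> blocks need
  \<open>((2l+1)^n - 1)/2\<close>. For the second inequality, a block of \<open>l\<close> quantifiers alone already has \<open>2l\<close> symbols.\<close>

section \<open>Distances and balls in the Gaifman graph\<close>

text \<open>Sets of centres replace the lists of \<open>nbhd\<close>, so that unions and images of
  families of points need no enumeration.\<close>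

definition ball_of :: "'r struc \<Rightarrow> nat \<Rightarrow> nat set \<Rightarrow> nat set" where
  "ball_of A r X = {c \<in> fst A. \<exists>a \<in> X. gdist_le A r a c}"

lemma nbhd_eq_ball_of: "nbhd A r as = ball_of A r (set as)"
  by (simp add: nbhd_def ball_of_def)

lemma ball_of_Un: "ball_of A r (X \<union> Y) = ball_of A r X \<union> ball_of A r Y"
  by (auto simp: ball_of_def)

lemma gedge_sym: "gedge A a b \<Longrightarrow> gedge A b a"
  by (auto simp: gedge_def)

lemma gedge_in: "is_struc ar A \<Longrightarrow> gedge A a b \<Longrightarrow> a \<in> fst A \<and> b \<in> fst A"
  unfolding gedge_def is_struc_def by blast

lemma gdist_le_in: "is_struc ar A \<Longrightarrow> gdist_le A r a c \<Longrightarrow> a \<in> fst A \<and> c \<in> fst A"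
  by (induction r arbitrary: c) (auto dest: gedge_in)

lemma gdist_le_mono: "gdist_le A r a c \<Longrightarrow> r \<le> s \<Longrightarrow> gdist_le A s a c"
  by (induction s) (auto simp: le_Suc_eq)

lemma gdist_le_refl: "a \<in> fst A \<Longrightarrow> gdist_le A r a a"
  using gdist_le_mono[of A 0 a a r] by simp

lemma gdist_le_trans: "gdist_le A r a b \<Longrightarrow> gdist_le A s b c \<Longrightarrow> gdist_le A (r + s) a c"
  by (induction s arbitrary: c) auto

lemma gedge_gdist_le: "is_struc ar A \<Longrightarrow> gedge A a b \<Longrightarrow> gdist_le A 1 a b"
  by (auto dest: gedge_in)

text \<open>Paths in \<open>gdist_le\<close> grow at the far end. The reversed path starts with the
  last edge, and transitivity appends the reversed remainder.\<close>

lemma gdist_le_sym: "is_struc ar A \<Longrightarrow> gdist_le A r a c \<Longrightarrow> gdist_le A r c a"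
proof (induction r arbitrary: c)
  case 0
  then show ?case by auto
next
  case (Suc r)
  show ?case
  proof (cases "gdist_le A r a c")
    case True
    then show ?thesis using Suc by simp
  next
    case False
    then obtain d where d: "gdist_le A r a d" "gedge A d c" using Suc.prems by auto
    have "gdist_le A (1 + r) c a"
      using gdist_le_trans[OF gedge_gdist_le[OF Suc.prems(1) gedge_sym[OF d(2)]] Suc.IH[OF Suc.prems(1) d(1)]] .
    then show ?thesis by simp
  qed
qed

lemma ball_of_mono:
  assumes "X \<subseteq> Y" "r \<le> s"
  shows "ball_of A r X \<subseteq> ball_of A s Y"
  using assms gdist_le_mono unfolding ball_of_def by blast

lemma ball_of_ball_of: "ball_of A r (ball_of A s X) \<subseteq> ball_of A (s + r) X"
  using gdist_le_trans unfolding ball_of_def by blast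

lemma subset_ball_of: "X \<subseteq> fst A \<Longrightarrow> X \<subseteq> ball_of A r X"
  using gdist_le_refl unfolding ball_of_def by blast

section \<open>Isomorphisms between spheres of families of points\<close>

text \<open>The distinguished points are the values of a family on an index set of any type.
  Variables of a valuation, positions of a tuple and the unit type for a single element are thus
  covered by one notion.\<close>

definition local_iso_by ::
    "(nat \<Rightarrow> nat) \<Rightarrow> ('r \<Rightarrow> nat) \<Rightarrow> nat \<Rightarrow> 'i set \<Rightarrow> 'r struc \<Rightarrow> ('i \<Rightarrow> nat) \<Rightarrow> 'r struc \<Rightarrow> ('i \<Rightarrow> nat) \<Rightarrow> bool" where
  "local_iso_by h ar r D A v B w \<longleftrightarrow> is_struc ar A \<and> is_struc ar B \<and> v ` D \<subseteq> fst A \<and> w ` D \<subseteq> fst B \<and>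
     bij_betw h (ball_of A r (v ` D)) (ball_of B r (w ` D)) \<and> (\<forall>x \<in> D. h (v x) = w x) \<and>
     (\<forall>R t. set t \<subseteq> ball_of A r (v ` D) \<longrightarrow> (t \<in> snd A R \<longleftrightarrow> map h t \<in> snd B R))"

definition local_iso ::
    "('r \<Rightarrow> nat) \<Rightarrow> nat \<Rightarrow> 'i set \<Rightarrow> 'r struc \<Rightarrow> ('i \<Rightarrow> nat) \<Rightarrow> 'r struc \<Rightarrow> ('i \<Rightarrow> nat) \<Rightarrow> bool" where
  "local_iso ar r D A v B w \<longleftrightarrow> (\<exists>h. local_iso_by h ar r D A v B w)"

lemma local_iso_byD:
  assumes "local_iso_by h ar r D A v B w"
  shows "is_struc ar A" "is_struc ar B" "v ` D \<subseteq> fst A" "w ` D \<subseteq> fst B"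
    "bij_betw h (ball_of A r (v ` D)) (ball_of B r (w ` D))"
    "\<And>x. x \<in> D \<Longrightarrow> h (v x) = w x"
    "\<And>R t. set t \<subseteq> ball_of A r (v ` D) \<Longrightarrow> t \<in> snd A R \<longleftrightarrow> map h t \<in> snd B R"
  using assms unfolding local_iso_by_def by simp_all

lemma local_iso_refl:
  assumes "is_struc ar A" "v ` D \<subseteq> fst A"
  shows "local_iso ar r D A v A v"
  using assms unfolding local_iso_def local_iso_by_def by (intro exI[of _ id]) auto

lemma local_iso_by_sym:
  assumes "local_iso_by h ar r D A v B w"
  shows "local_iso_by (inv_into (ball_of A r (v ` D)) h) ar r D B w A v"
proof -
  let ?N = "ball_of A r (v ` D)" and ?M = "ball_of B r (w ` D)"
  let ?g = "inv_into ?N h"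
  note a = local_iso_byD[OF assms]
  have g: "bij_betw ?g ?M ?N" using a(5) by (rule bij_betw_inv_into)
  have "?g (w x) = v x" if "x \<in> D" for x
    using a(6)[OF that] subset_ball_of[OF a(3)] that a(5)
    by (metis bij_betw_inv_into_left image_eqI subsetD)
  moreover have "t \<in> snd B R \<longleftrightarrow> map ?g t \<in> snd A R" if t: "set t \<subseteq> ?M" for R t
  proof -
    have "set (map ?g t) \<subseteq> ?N" using t g by (auto simp: bij_betw_def)
    moreover have "map h (map ?g t) = t"
      using t a(5) by (auto intro!: map_idI simp: bij_betw_inv_into_right subset_iff)
    ultimately show ?thesis using a(7) by metis
  qed
  ultimately show ?thesis using a g unfolding local_iso_by_def by blast
qed

lemma local_iso_sym: "local_iso ar r D A v B w \<Longrightarrow> local_iso ar r D B w A v"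
  unfolding local_iso_def using local_iso_by_sym by blast

lemma local_iso_trans:
  assumes "local_iso ar r D A v B w" "local_iso ar r D B w C u"
  shows "local_iso ar r D A v C u"
proof -
  obtain h g where h: "local_iso_by h ar r D A v B w" and g: "local_iso_by g ar r D B w C u"
    using assms unfolding local_iso_def by blast
  have "t \<in> snd A R \<longleftrightarrow> map (g \<circ> h) t \<in> snd C R" if t: "set t \<subseteq> ball_of A r (v ` D)" for t R
  proof -
    have "set (map h t) \<subseteq> ball_of B r (w ` D)"
      using t h unfolding local_iso_by_def bij_betw_def by (metis image_mono set_map)
    then show ?thesis using t h g unfolding local_iso_by_def by (metis map_map)
  qed
  moreover have "bij_betw (g \<circ> h) (ball_of A r (v ` D)) (ball_of C r (u ` D))"
    using bij_betw_trans[OF local_iso_byD(5)[OF h] local_iso_byD(5)[OF g]] .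
  ultimately have "local_iso_by (g \<circ> h) ar r D A v C u"
    using h g unfolding local_iso_by_def by simp
  then show ?thesis unfolding local_iso_def by blast
qed

text \<open>All elements of a tuple that witnesses the last edge of a path of length at most \<open>k\<close>
  are themselves within distance \<open>k\<close> of its start, so the sphere sees the path.\<close>

lemma local_iso_by_gdist_le:
  assumes h: "local_iso_by h ar r D A v B w" and a: "a \<in> ball_of A m (v ` D)"
  shows "m + k \<le> r \<Longrightarrow> gdist_le A k a c \<Longrightarrow> gdist_le B k (h a) (h c)"
proof (induction k arbitrary: c)
  case 0
  then have "a \<in> ball_of A r (v ` D)" using a ball_of_mono[OF order.refl, of m r A] by auto
  then have "h a \<in> ball_of B r (w ` D)" using h unfolding local_iso_by_def bij_betw_def by blast
  then show ?case using 0 unfolding ball_of_def by auto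
next
  case (Suc k)
  have A: "is_struc ar A" using h unfolding local_iso_by_def by blast
  have inN: "y \<in> ball_of A r (v ` D)" if y: "gdist_le A (Suc k) a y" for y
  proof -
    obtain x where "x \<in> v ` D" "gdist_le A m x a" using a unfolding ball_of_def by blast
    then have "gdist_le A r x y" using gdist_le_mono[OF gdist_le_trans[OF _ y] Suc.prems(1)] by blast
    then show ?thesis using \<open>x \<in> v ` D\<close> gdist_le_in[OF A y] unfolding ball_of_def by blast
  qed
  show ?case
  proof (cases "gdist_le A k a c")
    case True
    then show ?thesis using Suc by simp
  next
    case False
    then obtain d where d: "gdist_le A k a d" "gedge A d c" using Suc.prems by auto
    then obtain R t where t: "t \<in> snd A R" "d \<in> set t" "c \<in> set t" "d \<noteq> c"
      unfolding gedge_def by blast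
    have "gdist_le A (Suc k) a y" if "y \<in> set t" for y
      using d(1) t that by (cases "y = d") (auto simp: gedge_def)
    then have sub: "set t \<subseteq> ball_of A r (v ` D)" using inN by blast
    then have "map h t \<in> snd B R" using h t unfolding local_iso_by_def by blast
    moreover have "h d \<noteq> h c"
      using h t sub unfolding local_iso_by_def bij_betw_def inj_on_def by blast
    ultimately have "gedge B (h d) (h c)" using t unfolding gedge_def by force
    moreover have "gdist_le B k (h a) (h d)" using Suc d by simp
    ultimately show ?thesis by auto
  qed
qed

text \<open>Short paths that start within \<open>m\<close> of the points stay inside the
  \<open>r\<close>-sphere, so \<open>h\<close> preserves them. Its inverse is again a local
  isomorphism and pulls paths back, which gives the other inclusion.\<close>

lemma local_iso_by_image_ball_of:
  assumes h: "local_iso_by h ar r D A v B w" and X: "X \<subseteq> ball_of A m (v ` D)" and k: "m + k \<le> r"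
  shows "h ` ball_of A k X = ball_of B k (h ` X)"
proof -
  let ?N = "ball_of A r (v ` D)" and ?M = "ball_of B r (w ` D)"
  note A = local_iso_byD(1)[OF h] and B = local_iso_byD(2)[OF h] and sub = local_iso_byD(3,4)[OF h]
    and bij = local_iso_byD(5)[OF h] and hv = local_iso_byD(6)[OF h]
  let ?g = "inv_into ?N h"
  note g = local_iso_by_sym[OF h]
  have XN: "X \<subseteq> ?N" using X ball_of_mono[OF order.refl, of m r A "v ` D"] k by auto
  have hX: "h ` X \<subseteq> ball_of B m (w ` D)"
  proof
    fix b assume "b \<in> h ` X"
    then obtain a x where a: "a \<in> X" "b = h a" "x \<in> D" "gdist_le A m (v x) a"
      using X unfolding ball_of_def by blast
    moreover have "v x \<in> ball_of A 0 (v ` D)" using a(3) sub unfolding ball_of_def by auto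
    ultimately have "gdist_le B m (w x) b"
      using local_iso_by_gdist_le[OF h, of "v x" 0 m a] k hv by simp
    then show "b \<in> ball_of B m (w ` D)" using a(3) gdist_le_in[OF B] unfolding ball_of_def by blast
  qed
  show ?thesis
  proof
    show "h ` ball_of A k X \<subseteq> ball_of B k (h ` X)"
    proof
      fix b assume "b \<in> h ` ball_of A k X"
      then obtain a c where "b = h c" "a \<in> X" "gdist_le A k a c" unfolding ball_of_def by blast
      then have "gdist_le B k (h a) b" using local_iso_by_gdist_le[OF h _ k] X by blast
      then show "b \<in> ball_of B k (h ` X)"
        using \<open>a \<in> X\<close> gdist_le_in[OF B] unfolding ball_of_def by blast
    qed
    show "ball_of B k (h ` X) \<subseteq> h ` ball_of A k X"
    proof
      fix b assume "b \<in> ball_of B k (h ` X)"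
      then obtain a where a: "a \<in> X" "gdist_le B k (h a) b" unfolding ball_of_def by blast
      then have "gdist_le A k (?g (h a)) (?g b)" using local_iso_by_gdist_le[OF g _ k] hX by blast
      moreover have "?g (h a) = a" using a XN bij by (meson bij_betw_inv_into_left subsetD)
      ultimately have "?g b \<in> ball_of A k X" using a gdist_le_in[OF A] unfolding ball_of_def by auto
      moreover have "b \<in> ball_of B k (ball_of B m (w ` D))"
        using a hX gdist_le_in[OF B a(2)] unfolding ball_of_def by blast
      then have "b \<in> ?M"
        using ball_of_ball_of[of B k m] ball_of_mono[OF order.refl k, of B] by blast
      then have "h (?g b) = b" using bij by (simp add: bij_betw_inv_into_right)
      ultimately show "b \<in> h ` ball_of A k X" by (metis imageI)
    qed
  qed
qed

lemma local_iso_by_image_ball_of_pts: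
  assumes h: "local_iso_by h ar r D A v B w" and X: "X \<subseteq> D" and k: "k \<le> r"
  shows "h ` ball_of A k (v ` X) = ball_of B k (w ` X)"
proof -
  have "v ` X \<subseteq> ball_of A 0 (v ` D)" using subset_ball_of[OF local_iso_byD(3)[OF h]] X by blast
  moreover have "h ` v ` X = w ` X"
    unfolding image_image by (rule image_cong) (use X local_iso_byD(6)[OF h] in auto)
  ultimately show ?thesis
    using local_iso_by_image_ball_of[OF h, of "v ` X" 0 k] k by simp
qed

text \<open>New points at distance at most \<open>m\<close> from the old ones cost \<open>m\<close>
  of the radius: their \<open>k\<close>-balls still lie in the old sphere, so the same
  \<open>h\<close> serves.\<close>

lemma local_iso_by_restrict:
  assumes h: "local_iso_by h ar r D A v B w" and k: "m + k \<le> r"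
    and v': "v' ` D' \<subseteq> ball_of A m (v ` D)" and w': "\<And>x. x \<in> D' \<Longrightarrow> w' x = h (v' x)"
  shows "local_iso_by h ar k D' A v' B w'"
proof -
  note st = local_iso_byD(1,2)[OF h] and bij = local_iso_byD(5)[OF h] and R = local_iso_byD(7)[OF h]
  have w'': "w' ` D' = h ` v' ` D'" using w' by force
  have sub: "ball_of A k (v' ` D') \<subseteq> ball_of A r (v ` D)"
    using ball_of_mono[OF v' order.refl, of A k] ball_of_ball_of[of A k m "v ` D"]
      ball_of_mono[OF order.refl k, of A "v ` D"] by blast
  have vA: "v' ` D' \<subseteq> fst A" using v' unfolding ball_of_def by blast
  have im: "h ` ball_of A k (v' ` D') = ball_of B k (w' ` D')"
    using local_iso_by_image_ball_of[OF h v' k] w'' by simp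
  have "w' ` D' \<subseteq> ball_of B k (w' ` D')"
    using subset_ball_of[OF vA, of k] im w'' by blast
  then have "w' ` D' \<subseteq> fst B" unfolding ball_of_def by blast
  then show ?thesis unfolding local_iso_by_def
    using st vA bij_betw_subset[OF bij sub im] w' R sub by auto
qed

text \<open>Besides shrinking the radius this changes the index set, possibly to another type. All
  that matters is that every new pair of points occurs among the old pairs.\<close>

lemma local_iso_mono:
  assumes "local_iso ar r D A v B w" and k: "k \<le> r"
    and D': "\<And>x. x \<in> D' \<Longrightarrow> \<exists>y \<in> D. v' x = v y \<and> w' x = w y"
  shows "local_iso ar k D' A v' B w'"
proof -
  obtain h where h: "local_iso_by h ar r D A v B w" using assms(1) unfolding local_iso_def by blast
  note hv = local_iso_byD(6)[OF h] and subset_ball_of[OF local_iso_byD(3)[OF h], of 0]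
  then have "v' ` D' \<subseteq> ball_of A 0 (v ` D)" using D' by (metis image_subset_iff)
  moreover have "w' x = h (v' x)" if "x \<in> D'" for x using D'[OF that] hv by metis
  ultimately have "local_iso_by h ar k D' A v' B w'" using local_iso_by_restrict[OF h, of 0 k v' D' w'] k by simp
  then show ?thesis unfolding local_iso_def by blast
qed

section \<open>Linked points and gluing of spheres\<close>

text \<open>Linkedness is read off the \<open>r\<close>-sphere of all points alone. Two balls joined only by a tuple
  that leaves the sphere count as unlinked; this keeps the notion invariant under local
  isomorphisms.\<close>

definition linked :: "nat \<Rightarrow> 'i set \<Rightarrow> 'i set \<Rightarrow> 'r struc \<Rightarrow> ('i \<Rightarrow> nat) \<Rightarrow> 'i \<Rightarrow> bool" where
  "linked r D E A u i \<longleftrightarrow> ball_of A r (u ` D) \<inter> ball_of A r {u i} \<noteq> {} \<or>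
     (\<exists>R. \<exists>t \<in> snd A R. set t \<subseteq> ball_of A r (u ` (D \<union> E)) \<and>
        set t \<inter> ball_of A r (u ` D) \<noteq> {} \<and> set t \<inter> ball_of A r {u i} \<noteq> {})"

text \<open>One map \<open>h\<close> carries the balls around \<open>D\<close>, around the point at
  \<open>i\<close> and around all points to their counterparts, so it moves either kind of witness
  to one of the same kind.\<close>

lemma linked_local_iso_imp:
  assumes "local_iso ar r (D \<union> E) A u B w" and i: "i \<in> E" and l: "linked r D E A u i"
  shows "linked r D E B w i"
proof -
  obtain h where h: "local_iso_by h ar r (D \<union> E) A u B w"
    using assms(1) unfolding local_iso_def by blast
  have iD: "h ` ball_of A r (u ` D) = ball_of B r (w ` D)"
    and iE: "h ` ball_of A r (u ` (D \<union> E)) = ball_of B r (w ` (D \<union> E))"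
    using local_iso_by_image_ball_of_pts[OF h] by auto
  have ii: "h ` ball_of A r {u i} = ball_of B r {w i}"
    using local_iso_by_image_ball_of_pts[OF h, of "{i}" r] i by auto
  from l consider (meet) c where "c \<in> ball_of A r (u ` D)" "c \<in> ball_of A r {u i}"
    | (tup) R t c d where "t \<in> snd A R" "set t \<subseteq> ball_of A r (u ` (D \<union> E))"
        "c \<in> set t" "c \<in> ball_of A r (u ` D)" "d \<in> set t" "d \<in> ball_of A r {u i}"
    unfolding linked_def by blast
  then show ?thesis
  proof cases
    case meet
    then have "h c \<in> ball_of B r (w ` D) \<inter> ball_of B r {w i}" using iD ii by blast
    then show ?thesis unfolding linked_def by blast
  next
    case tup
    then have "map h t \<in> snd B R" using h unfolding local_iso_by_def by blast
    moreover have "set (map h t) \<subseteq> ball_of B r (w ` (D \<union> E))" using tup iE by auto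
    moreover have "h c \<in> set (map h t) \<inter> ball_of B r (w ` D)" "h d \<in> set (map h t) \<inter> ball_of B r {w i}"
      using tup iD ii by auto
    ultimately show ?thesis unfolding linked_def by blast
  qed
qed

lemma linked_local_iso:
  "local_iso ar r (D \<union> E) A u B w \<Longrightarrow> i \<in> E \<Longrightarrow> linked r D E A u i \<longleftrightarrow> linked r D E B w i"
  using linked_local_iso_imp[of ar r D E A u B w i] linked_local_iso_imp[of ar r D E B w A u i]
    local_iso_sym[of ar r "D \<union> E" A u B w] by blast

text \<open>The source of the constant \<open>2 * r + 1\<close>: \<open>r\<close> steps from
  \<open>D\<close> to \<open>c\<close>, at most one step along the joining tuple, and
  \<open>r\<close> steps from \<open>d\<close> to the linked point.\<close>

lemma linked_in_ball_of:
  assumes A: "is_struc ar A" and l: "linked r D E A u i"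
  shows "u i \<in> ball_of A (2 * r + 1) (u ` D)"
proof -
  obtain c d where c: "c \<in> ball_of A r (u ` D)" and d: "d \<in> ball_of A r {u i}" and cd: "gdist_le A 1 c d"
  proof -
    from l consider (meet) c where "c \<in> ball_of A r (u ` D)" "c \<in> ball_of A r {u i}"
    | (tup) R t c d where "t \<in> snd A R"
        "c \<in> set t" "c \<in> ball_of A r (u ` D)" "d \<in> set t" "d \<in> ball_of A r {u i}"
      unfolding linked_def by blast
    then show thesis
    proof cases
      case meet
      then show thesis using that gdist_le_refl[of c A 1] unfolding ball_of_def by blast
    next
      case tup
      have "gdist_le A 1 c d"
      proof (cases "c = d")
        case True
        then show ?thesis using tup(3) gdist_le_refl unfolding ball_of_def by blast
      next
        case False
        then have "gedge A c d" using tup unfolding gedge_def by blast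
        then show ?thesis using gedge_gdist_le[OF A] by blast
      qed
      then show thesis using that tup by blast
    qed
  qed
  obtain a where a: "a \<in> u ` D" "gdist_le A r a c" using c unfolding ball_of_def by blast
  have "gdist_le A r d (u i)" using d gdist_le_sym[OF A] unfolding ball_of_def by blast
  then have "gdist_le A (r + 1 + r) a (u i)" using a cd gdist_le_trans by blast
  then have "gdist_le A (2 * r + 1) a (u i)" by (simp add: mult_2)
  then show ?thesis using a gdist_le_in[OF A] unfolding ball_of_def by blast
qed

text \<open>A tuple inside the union of the two balls stays in the sphere of all points, so it is
  one that \<open>linked\<close> does register; it cannot meet both sides.\<close>

lemma not_linked_disjoint:
  assumes "\<forall>i \<in> E. \<not> linked r D E A u i"
  shows "ball_of A r (u ` D) \<inter> ball_of A r (u ` E) = {}"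
    and "t \<in> snd A R \<Longrightarrow> set t \<subseteq> ball_of A r (u ` D) \<union> ball_of A r (u ` E) \<Longrightarrow>
      set t \<subseteq> ball_of A r (u ` D) \<or> set t \<subseteq> ball_of A r (u ` E)"
proof -
  have E: "\<exists>i \<in> E. c \<in> ball_of A r {u i}" if "c \<in> ball_of A r (u ` E)" for c
    using that unfolding ball_of_def by blast
  show "ball_of A r (u ` D) \<inter> ball_of A r (u ` E) = {}"
    using assms E unfolding linked_def by blast
  assume t: "t \<in> snd A R" "set t \<subseteq> ball_of A r (u ` D) \<union> ball_of A r (u ` E)"
  show "set t \<subseteq> ball_of A r (u ` D) \<or> set t \<subseteq> ball_of A r (u ` E)"
  proof (rule ccontr)
    assume "\<not> ?thesis"
    then obtain c d where c: "c \<in> set t" "c \<in> ball_of A r (u ` D)"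
      and d: "d \<in> set t" "d \<in> ball_of A r (u ` E)" using t by blast
    then obtain i where i: "i \<in> E" "d \<in> ball_of A r {u i}" using E by blast
    have "set t \<subseteq> ball_of A r (u ` (D \<union> E))" using t by (simp add: image_Un ball_of_Un)
    then have "linked r D E A u i" unfolding linked_def using t c d i by blast
    then show False using assms i by blast
  qed
qed

text \<open>The two maps are glued. Disjointness of the balls makes the result well defined and
  bijective, and as no tuple crosses between the sides, each relation is checked on one side
  only.\<close>

lemma local_iso_union:
  assumes "local_iso ar r D A u B w" "local_iso ar r E A u B w"
    and nA: "\<forall>i \<in> E. \<not> linked r D E A u i" and nB: "\<forall>i \<in> E. \<not> linked r D E B w i"
  shows "local_iso ar r (D \<union> E) A u B w"
proof -
  obtain g h where g: "local_iso_by g ar r D A u B w" and h: "local_iso_by h ar r E A u B w"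
    using assms unfolding local_iso_def by blast
  let ?N = "ball_of A r (u ` D)" and ?N' = "ball_of A r (u ` E)"
  let ?M = "ball_of B r (w ` D)" and ?M' = "ball_of B r (w ` E)"
  define f where "f c = (if c \<in> ?N then g c else h c)" for c
  note dA = not_linked_disjoint[OF nA] and dB = not_linked_disjoint[OF nB]
  note bg = local_iso_byD(5)[OF g] and bh = local_iso_byD(5)[OF h]
    and uD = local_iso_byD(3)[OF g] and uE = local_iso_byD(3)[OF h]
  have fg: "f c = g c" if "c \<in> ?N" for c using that by (simp add: f_def)
  have fh: "f c = h c" if "c \<in> ?N'" for c using that dA(1) by (auto simp: f_def)
  have bf: "bij_betw f ?N ?M" "bij_betw f ?N' ?M'"
    using bg bh bij_betw_cong[of ?N f g] bij_betw_cong[of ?N' f h] fg fh by auto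
  have bij: "bij_betw f (?N \<union> ?N') (?M \<union> ?M')"
    using bij_betw_combine[OF bf dB(1)] .
  have pts: "f (u x) = w x" if "x \<in> D \<union> E" for x
    using that
  proof
    assume x: "x \<in> D"
    then have "u x \<in> ?N" using subset_ball_of[OF uD] by blast
    then show ?thesis using g x fg unfolding local_iso_by_def by simp
  next
    assume x: "x \<in> E"
    then have "u x \<in> ?N'" using subset_ball_of[OF uE] by blast
    then show ?thesis using h x fh unfolding local_iso_by_def by simp
  qed
  have tD: "t \<in> snd A R \<longleftrightarrow> map f t \<in> snd B R" if "set t \<subseteq> ?N" for t R
  proof -
    have "map f t = map g t" using that fg by (auto intro: map_cong)
    then show ?thesis using g that unfolding local_iso_by_def by metis
  qed
  have tE: "t \<in> snd A R \<longleftrightarrow> map f t \<in> snd B R" if "set t \<subseteq> ?N'" for t R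
  proof -
    have "map f t = map h t" using that fh by (auto intro: map_cong)
    then show ?thesis using h that unfolding local_iso_by_def by metis
  qed
  have tup: "t \<in> snd A R \<longleftrightarrow> map f t \<in> snd B R" if t: "set t \<subseteq> ?N \<union> ?N'" for t R
  proof
    assume "t \<in> snd A R"
    then show "map f t \<in> snd B R" using dA(2)[OF _ t] tD tE by blast
  next
    \<comment> \<open>The tuple in \<open>B\<close> lies on one side. Since \<open>f\<close> maps
      each side of \<open>A\<close> to its own side of \<open>B\<close>, the preimage lies on one
      side as well.\<close>
    assume B: "map f t \<in> snd B R"
    have "set (map f t) \<subseteq> ?M \<union> ?M'" using t bij unfolding bij_betw_def by auto
    then have "set (map f t) \<subseteq> ?M \<or> set (map f t) \<subseteq> ?M'" using dB(2)[OF B] by blast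
    then have "set t \<subseteq> ?N \<or> set t \<subseteq> ?N'"
    proof
      assume "set (map f t) \<subseteq> ?M"
      then have "f c \<notin> ?M'" if "c \<in> set t" for c using that dB(1) by auto
      then show ?thesis using t bf(2) unfolding bij_betw_def by blast
    next
      assume "set (map f t) \<subseteq> ?M'"
      then have "f c \<notin> ?M" if "c \<in> set t" for c using that dB(1) by auto
      then show ?thesis using t bf(1) unfolding bij_betw_def by blast
    qed
    then show "t \<in> snd A R" using tD tE B by blast
  qed
  have "local_iso_by f ar r (D \<union> E) A u B w"
    unfolding local_iso_by_def image_Un ball_of_Un
    using g h bij pts tup unfolding local_iso_by_def by simp
  then show ?thesis unfolding local_iso_def by blast
qed

section \<open>Extensions of a valuation\<close>

text \<open>Tuples over \<open>E\<close> are encoded as total valuations that agree with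
  \<open>v\<close> elsewhere. This keeps the set finite for finite \<open>E\<close>, and its members
  can be passed to \<open>sat\<close>.\<close>

definition extensions :: "'r struc \<Rightarrow> ('i \<Rightarrow> nat) \<Rightarrow> 'i set \<Rightarrow> ('i \<Rightarrow> nat) set" where
  "extensions A v E = {u. (\<forall>x \<in> E. u x \<in> fst A) \<and> (\<forall>x. x \<notin> E \<longrightarrow> u x = v x)}"

lemma extensionsD:
  assumes "u \<in> extensions A v E"
  shows "x \<in> E \<Longrightarrow> u x \<in> fst A" "x \<notin> E \<Longrightarrow> u x = v x"
  using assms by (simp_all add: extensions_def)

lemma extensions_empty: "extensions A v {} = {v}"
  by (auto simp: extensions_def)

lemma extensions_insert:
  assumes "e \<notin> E"
  shows "extensions A v (insert e E) = (\<Union>x \<in> fst A. extensions A (v(e := x)) E)"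
  using assms unfolding extensions_def by (auto split: if_splits)

lemma finite_extensions:
  assumes "finite E" "finite (fst A)"
  shows "finite (extensions A v E)"
  using assms(1)
proof (induction E arbitrary: v)
  case empty
  then show ?case by (simp add: extensions_empty)
next
  case (insert e E)
  then show ?case using assms(2) by (simp add: extensions_insert)
qed

text \<open>The extensions are sorted by their value at \<open>e\<close>, which extending over
  \<open>E\<close> cannot change.\<close>

lemma card_extensions_insert:
  assumes "finite E" "finite (fst A)" "e \<notin> E"
  shows "card {u \<in> extensions A v (insert e E). P u} =
    (\<Sum>x \<in> fst A. card {u \<in> extensions A (v(e := x)) E. P u})"
proof -
  have "{u \<in> extensions A v (insert e E). P u} = (\<Union>x \<in> fst A. {u \<in> extensions A (v(e := x)) E. P u})"
    using extensions_insert[OF assms(3)] by blast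
  moreover have "u e = x" if "u \<in> extensions A (v(e := x)) E" for u x
    using that assms(3) by (auto simp: extensions_def)
  then have "{u \<in> extensions A (v(e := x)) E. P u} \<inter> {u \<in> extensions A (v(e := y)) E. P u} = {}"
    if "x \<noteq> y" for x y using that by blast
  ultimately show ?thesis
    using card_UN_disjoint[of "fst A" "\<lambda>x. {u \<in> extensions A (v(e := x)) E. P u}"]
      assms finite_extensions[OF assms(1,2)] by simp
qed

section \<open>Counting the realisations of sphere types\<close>

text \<open>\<open>P\<close> takes the structure as an argument so that one property can be counted
  in two structures.\<close>

definition sphere_invariant ::
    "('r \<Rightarrow> nat) \<Rightarrow> nat \<Rightarrow> 'i set \<Rightarrow> ('r struc \<Rightarrow> ('i \<Rightarrow> nat) \<Rightarrow> bool) \<Rightarrow> bool" where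
  "sphere_invariant ar r D P \<longleftrightarrow> (\<forall>A v B w. local_iso ar r D A v B w \<longrightarrow> P A v = P B w)"

lemma sphere_invariant_mono:
  assumes "sphere_invariant ar r D P" "D \<subseteq> D'"
  shows "sphere_invariant ar r D' P"
  unfolding sphere_invariant_def
proof (intro allI impI)
  fix A v B w assume "local_iso ar r D' A v B w"
  then have "local_iso ar r D A v B w" using local_iso_mono[of ar r D' A v B w r D v w] assms(2) by blast
  then show "P A v = P B w" using assms(1) unfolding sphere_invariant_def by blast
qed

text \<open>A tuple may be linked through several indices; charging it to the least one counts it
  exactly once.\<close>

lemma card_partition_by_least:
  fixes Q :: "'i::wellorder \<Rightarrow> 'a \<Rightarrow> bool"
  assumes "finite X" "finite E"
  shows "card {u \<in> X. \<exists>i \<in> E. Q i u} = (\<Sum>i \<in> E. card {u \<in> X. Q i u \<and> (\<forall>j \<in> E. j < i \<longrightarrow> \<not> Q j u)})"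
proof -
  let ?Y = "\<lambda>i. {u \<in> X. Q i u \<and> (\<forall>j \<in> E. j < i \<longrightarrow> \<not> Q j u)}"
  have "\<exists>i \<in> E. Q i u \<and> (\<forall>j \<in> E. j < i \<longrightarrow> \<not> Q j u)" if "\<exists>i \<in> E. Q i u" for u
    using that exists_least_iff[of "\<lambda>i. i \<in> E \<and> Q i u"] by blast
  then have "{u \<in> X. \<exists>i \<in> E. Q i u} = (\<Union>i \<in> E. ?Y i)" by blast
  moreover have "?Y i \<inter> ?Y j = {}" if "i \<in> E" "j \<in> E" "i \<noteq> j" for i j
    using that by (cases i j rule: linorder_cases) auto
  ultimately show ?thesis using card_UN_disjoint[of E ?Y] assms by simp
qed

text \<open>What remains of \<open>r_equiv\<close> when the distinguished tuples are forgotten: only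
  spheres of single elements are compared.\<close>

definition hanf_bij :: "('r \<Rightarrow> nat) \<Rightarrow> nat \<Rightarrow> 'r struc \<Rightarrow> 'r struc \<Rightarrow> (nat \<Rightarrow> nat) \<Rightarrow> bool" where
  "hanf_bij ar r A B f \<longleftrightarrow> bij_betw f (fst A) (fst B) \<and>
     (\<forall>x \<in> fst A. local_iso ar r {()} A (\<lambda>_. x) B (\<lambda>_. f x))"

lemma hanf_bij_sym:
  assumes "hanf_bij ar r A B f"
  shows "hanf_bij ar r B A (inv_into (fst A) f)"
proof -
  have f: "bij_betw f (fst A) (fst B)" using assms unfolding hanf_bij_def by blast
  have "local_iso ar r {()} B (\<lambda>_. y) A (\<lambda>_. inv_into (fst A) f y)" if "y \<in> fst B" for y
  proof -
    have "inv_into (fst A) f y \<in> fst A" "f (inv_into (fst A) f y) = y"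
      using f that by (auto simp: bij_betw_def inv_into_into f_inv_into_f)
    then show ?thesis using assms local_iso_sym unfolding hanf_bij_def by metis
  qed
  then show ?thesis using bij_betw_inv_into[OF f] unfolding hanf_bij_def by blast
qed

text \<open>Every realisation of an invariant property \<open>P\<close> is either linked to \<open>D\<close> or not. A linked one has an
  entry in the isomorphic \<open>(2r+1)\<close>-balls around \<open>D\<close>, and the induction hypothesis counts the ways
  to choose the remaining entries. The unlinked ones are counted as all realisations of the type
  over \<open>E\<close> minus the linked ones; for the former, the bijection \<open>f\<close> serves one entry and the
  induction hypothesis the others.\<close>

lemma card_extensions_eq:
  fixes D E :: "nat set"
  assumes A: "is_struc ar A" and B: "is_struc ar B" and f: "hanf_bij ar R A B f"
    and "finite E" "D \<inter> E = {}" "(2 * r + 1) * card E + r \<le> R"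
    and "local_iso ar ((2 * r + 1) * card E + r) D A v B w"
    and "sphere_invariant ar r (D \<union> E) P"
  shows "card {u \<in> extensions A v E. P A u} = card {u \<in> extensions B w E. P B u}"
  using assms(4-)
proof (induction "card E" arbitrary: E D v w P)
  case 0
  then have E: "E = {}" by simp
  then have "local_iso ar r D A v B w" "sphere_invariant ar r D P" using 0 by simp_all
  then have "P A v \<longleftrightarrow> P B w" unfolding sphere_invariant_def by blast
  moreover have "{u. u = x \<and> Q u} = (if Q x then {x} else {})" for x :: "nat \<Rightarrow> nat" and Q
    by auto
  ultimately show ?case by (simp add: E extensions_empty)
next
  case (Suc n)
  define L where "L = 2 * r + 1"
  have finA: "finite (fst A)" and finB: "finite (fst B)" using A B unfolding is_struc_def by blast+
  note finE = Suc.prems(1)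
  \<comment> \<open>Fixing one entry uses up \<open>L\<close> of the radius;
    \<open>L * n + r\<close> is what the induction hypothesis needs for the other \<open>n\<close>
    entries.\<close>
  have rad: "L * card E + r = L + (L * n + r)" using Suc.hyps(2)[symmetric] by simp
  obtain h where h: "local_iso_by h ar (L * card E + r) D A v B w"
    using Suc.prems(4) unfolding local_iso_def L_def by blast
  \<comment> \<open>The fixed points \<open>D'\<close> are left open: \<open>insert i D\<close> is
    taken for linked realisations, a single index without \<open>D\<close> for the total
    count.\<close>
  have IH: "card {u \<in> extensions A v' (E - {i}). Q A u} = card {u \<in> extensions B w' (E - {i}). Q B u}"
    if "i \<in> E" "D' \<inter> (E - {i}) = {}" "local_iso ar (L * n + r) D' A v' B w'"
      "sphere_invariant ar r (D' \<union> (E - {i})) Q" for i D' v' w' Q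
  proof -
    have n: "n = card (E - {i})" using Suc.hyps(2) that(1) finE by simp
    have "L * n + r \<le> R" using Suc.prems(3) rad unfolding L_def by simp
    then show ?thesis using Suc.hyps(1)[OF n _ that(2) _ _ that(4)] finE that(3) n unfolding L_def by simp
  qed
  have ins: "insert i (E - {i}) = E" if "i \<in> E" for i using that by blast
  have linked_i: "card {u \<in> extensions A v E. Q A u} = card {u \<in> extensions B w E. Q B u}"
    if i: "i \<in> E" and Q: "sphere_invariant ar r (D \<union> E) Q"
      and Ql: "\<And>S u. Q S u \<Longrightarrow> linked r D E S u i" for i Q
  proof -
    let ?N = "ball_of A L (v ` D)" and ?M = "ball_of B L (w ` D)"
    have fixD: "u ` D = v' ` D" if u: "u \<in> extensions S (v'(i := x)) (E - {i})"
      for u v' x and S :: "'a struc"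
    proof (rule image_cong[OF refl])
      fix y assume "y \<in> D"
      then have "y \<notin> E - {i}" "y \<noteq> i" using Suc.prems(2) i by blast+
      then show "u y = v' y" using extensionsD(2)[OF u, of y] by simp
    qed
    \<comment> \<open>Values at \<open>i\<close> outside the ball contribute nothing, so the sum
      over the universe shrinks to the ball, where \<open>h\<close> provides the reindexing.\<close>
    have outside: "card {u \<in> extensions S (v'(i := x)) (E - {i}). Q S u} = 0"
      if S: "is_struc ar S" and x: "x \<notin> ball_of S L (v' ` D)" for S v' x
    proof -
      have "\<not> Q S u" if u: "u \<in> extensions S (v'(i := x)) (E - {i})" for u
      proof
        assume "Q S u"
        then have "u i \<in> ball_of S L (u ` D)" using linked_in_ball_of[OF S Ql] unfolding L_def by blast
        moreover have "u i = x" using extensionsD(2)[OF u, of i] by simp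
        ultimately show False using x fixD[OF u] by simp
      qed
      then show ?thesis by (metis (mono_tags, lifting) card.empty empty_Collect_eq)
    qed
    have sum: "card {u \<in> extensions S v' E. Q S u} =
        (\<Sum>x \<in> ball_of S L (v' ` D). card {u \<in> extensions S (v'(i := x)) (E - {i}). Q S u})"
      if S: "is_struc ar S" for S v'
    proof -
      have "finite (fst S)" using S unfolding is_struc_def by blast
      then have "card {u \<in> extensions S v' E. Q S u} =
        (\<Sum>x \<in> fst S. card {u \<in> extensions S (v'(i := x)) (E - {i}). Q S u})"
        using card_extensions_insert[of "E - {i}" S i v' "Q S"] finE ins[OF i] by simp
      also have "\<dots> = (\<Sum>x \<in> ball_of S L (v' ` D). card {u \<in> extensions S (v'(i := x)) (E - {i}). Q S u})"
        using \<open>finite (fst S)\<close> outside[OF S] by (intro sum.mono_neutral_right) (auto simp: ball_of_def)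
      finally show ?thesis .
    qed
    have im: "h ` ?N = ?M" using local_iso_by_image_ball_of_pts[OF h order.refl, of L] rad by simp
    have "?N \<subseteq> ball_of A (L * card E + r) (v ` D)" using rad by (intro ball_of_mono) auto
    then have bij: "bij_betw h ?N ?M" using bij_betw_subset[OF local_iso_byD(5)[OF h] _ im] by blast
    have "card {u \<in> extensions A (v(i := x)) (E - {i}). Q A u} =
        card {u \<in> extensions B (w(i := h x)) (E - {i}). Q B u}" if x: "x \<in> ?N" for x
    proof (rule IH[OF i])
      show "insert i D \<inter> (E - {i}) = {}" using Suc.prems(2) by blast
      show "sphere_invariant ar r (insert i D \<union> (E - {i})) Q"
        using Q i by (metis Un_insert_left Un_insert_right ins)
      have "(v(i := x)) ` insert i D \<subseteq> ?N"
        using x subset_ball_of[OF local_iso_byD(3)[OF h], of L] by auto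
      moreover have "(w(i := h x)) y = h ((v(i := x)) y)" if "y \<in> insert i D" for y
        using that local_iso_byD(6)[OF h] by auto
      ultimately have "local_iso_by h ar (L * n + r) (insert i D) A (v(i := x)) B (w(i := h x))"
        using local_iso_by_restrict[OF h, of L "L * n + r" "v(i := x)" "insert i D" "w(i := h x)"] rad by simp
      then show "local_iso ar (L * n + r) (insert i D) A (v(i := x)) B (w(i := h x))"
        unfolding local_iso_def by blast
    qed
    then show ?thesis unfolding sum[OF A] sum[OF B]
      using sum.reindex_bij_betw[OF bij, of "\<lambda>y. card {u \<in> extensions B (w(i := y)) (E - {i}). Q B u}"] by simp
  qed
  have linked_any: "card {u \<in> extensions A v E. Q A u \<and> (\<exists>i \<in> E. linked r D E A u i)} =
      card {u \<in> extensions B w E. Q B u \<and> (\<exists>i \<in> E. linked r D E B u i)}"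
    if Q: "sphere_invariant ar r (D \<union> E) Q" for Q
  proof -
    \<comment> \<open>Linked at \<open>i\<close> and at no smaller index. This is still sphere
      invariant, because linkedness at every index of \<open>E\<close> is.\<close>
    let ?Q = "\<lambda>i S u. (Q S u \<and> linked r D E S u i) \<and> (\<forall>j \<in> E. j < i \<longrightarrow> \<not> (Q S u \<and> linked r D E S u j))"
    have part: "card {u \<in> extensions S v' E. Q S u \<and> (\<exists>i \<in> E. linked r D E S u i)} =
        (\<Sum>i \<in> E. card {u \<in> extensions S v' E. ?Q i S u})" if "finite (fst S)" for S v'
      using card_partition_by_least[OF finite_extensions[OF finE that, of v'] finE,
          of "\<lambda>i u. Q S u \<and> linked r D E S u i"] by simp
    have "card {u \<in> extensions A v E. ?Q i A u} = card {u \<in> extensions B w E. ?Q i B u}" if i: "i \<in> E" for i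
    proof (rule linked_i[OF i])
      show "sphere_invariant ar r (D \<union> E) (?Q i)"
        unfolding sphere_invariant_def
      proof (intro allI impI)
        fix S v S' v' assume iso: "local_iso ar r (D \<union> E) S v S' v'"
        have "Q S v = Q S' v'" using Q iso unfolding sphere_invariant_def by blast
        moreover have "linked r D E S v j = linked r D E S' v' j" if "j \<in> E" for j
          using linked_local_iso[OF iso that] .
        ultimately show "?Q i S v = ?Q i S' v'" using i by auto
      qed
    qed blast
    then show ?thesis unfolding part[OF finA] part[OF finB] by (rule sum.cong[OF refl])
  qed
  \<comment> \<open>\<open>Q\<close> replaces \<open>P\<close> by a property of the sphere over
    \<open>E\<close> alone: some structure has an unlinked realisation of \<open>P\<close> with the
    given sphere over \<open>D\<close> and the same sphere over \<open>E\<close> as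
    \<open>u\<close>.\<close>
  define Q where "Q S u \<longleftrightarrow> (\<exists>S0 u0. local_iso ar r D A v S0 u0 \<and> P S0 u0 \<and>
      (\<forall>i \<in> E. \<not> linked r D E S0 u0 i) \<and> local_iso ar r E S0 u0 S u)" for S u
  have QE: "sphere_invariant ar r E Q"
    unfolding sphere_invariant_def
  proof (intro allI impI)
    fix S u S' u' assume iso: "local_iso ar r E S u S' u'"
    show "Q S u = Q S' u'"
      unfolding Q_def using local_iso_trans[OF _ iso] local_iso_trans[OF _ local_iso_sym[OF iso]] by blast
  qed
  \<comment> \<open>For an unlinked \<open>u\<close> the spheres over \<open>D\<close> and over
    \<open>E\<close> determine the sphere over both by gluing, and \<open>P\<close> depends on
    nothing else.\<close>
  have unlinked: "P S u \<longleftrightarrow> Q S u"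
    if S: "is_struc ar S" and D: "local_iso ar r D A v S u" and u: "u ` E \<subseteq> fst S"
      and n: "\<forall>i \<in> E. \<not> linked r D E S u i" for S u
  proof
    assume "P S u"
    then show "Q S u" unfolding Q_def using D n local_iso_refl[OF S u] by blast
  next
    assume "Q S u"
    then obtain S0 u0 where 0: "local_iso ar r D A v S0 u0" "P S0 u0"
      "\<forall>i \<in> E. \<not> linked r D E S0 u0 i" "local_iso ar r E S0 u0 S u" unfolding Q_def by blast
    have "local_iso ar r (D \<union> E) S0 u0 S u"
      using local_iso_union[OF local_iso_trans[OF local_iso_sym[OF 0(1)] D] 0(4,3) n] .
    then show "P S u" using 0(2) Suc.prems(5) unfolding sphere_invariant_def by blast
  qed
  have total: "card {u \<in> extensions A v E. Q A u} = card {u \<in> extensions B w E. Q B u}"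
  proof -
    \<comment> \<open>As \<open>Q\<close> ignores \<open>D\<close>, the index \<open>e\<close> alone
      can be the fixed point; \<open>f\<close> matches its values with a large enough
      radius.\<close>
    obtain e where e: "e \<in> E" using Suc.hyps(2) by fastforce
    have "card {u \<in> extensions A (v(e := x)) (E - {e}). Q A u} =
        card {u \<in> extensions B (w(e := f x)) (E - {e}). Q B u}" if x: "x \<in> fst A" for x
    proof (rule IH[OF e])
      show "{e} \<inter> (E - {e}) = {}" by blast
      show "sphere_invariant ar r ({e} \<union> (E - {e})) Q" using QE ins[OF e] by simp
      have "local_iso ar R {()} A (\<lambda>_. x) B (\<lambda>_. f x)" using f x unfolding hanf_bij_def by blast
      moreover have "L * n + r \<le> R" using Suc.prems(3) rad unfolding L_def by simp
      ultimately show "local_iso ar (L * n + r) {e} A (v(e := x)) B (w(e := f x))"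
        by (rule local_iso_mono) simp
    qed
    moreover have "bij_betw f (fst A) (fst B)" using f unfolding hanf_bij_def by blast
    ultimately show ?thesis
      using card_extensions_insert[of "E - {e}" A e v "Q A"] card_extensions_insert[of "E - {e}" B e w "Q B"]
        finA finB finE ins[OF e]
        sum.reindex_bij_betw[of f "fst A" "fst B" "\<lambda>y. card {u \<in> extensions B (w(e := y)) (E - {e}). Q B u}"]
      by simp
  qed
  have split: "card {u \<in> extensions S v' E. P' u} =
      card {u \<in> extensions S v' E. P' u \<and> (\<exists>i \<in> E. linked r D E S u i)} +
      card {u \<in> extensions S v' E. P' u \<and> (\<forall>i \<in> E. \<not> linked r D E S u i)}"
    if "finite (fst S)" for S v' P'
  proof -
    note fin = finite_extensions[OF finE that, of v']
    have "{u \<in> extensions S v' E. P' u} =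
       {u \<in> extensions S v' E. P' u \<and> (\<exists>i \<in> E. linked r D E S u i)} \<union>
       {u \<in> extensions S v' E. P' u \<and> (\<forall>i \<in> E. \<not> linked r D E S u i)}" by blast
    then show ?thesis using fin by (simp only:, subst card_Un_disjoint) auto
  qed
  have PQ: "{u \<in> extensions S v' E. P S u \<and> (\<forall>i \<in> E. \<not> linked r D E S u i)} =
      {u \<in> extensions S v' E. Q S u \<and> (\<forall>i \<in> E. \<not> linked r D E S u i)}"
    if S: "is_struc ar S" and D: "local_iso ar r D A v S v'" for S v'
  proof -
    have "P S u \<longleftrightarrow> Q S u" if u: "u \<in> extensions S v' E" and n: "\<forall>i \<in> E. \<not> linked r D E S u i" for u
    proof (rule unlinked[OF S _ _ n])
      have "u x = v' x" if "x \<in> D" for x using extensionsD(2)[OF u] that Suc.prems(2) by blast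
      then show "local_iso ar r D A v S u" by (intro local_iso_mono[OF D order.refl]) auto
      show "u ` E \<subseteq> fst S" using extensionsD(1)[OF u] by blast
    qed
    then show ?thesis by blast
  qed
  have iso: "local_iso ar r D A v B w" using Suc.prems(4) by (rule local_iso_mono) auto
  have "local_iso ar r D A v A v" using local_iso_refl[OF A] local_iso_byD(3)[OF h] by blast
  note PQ = PQ[OF A this] PQ[OF B iso]
  \<comment> \<open>The linked realisations of \<open>Q\<close> are subtracted from all of them. On
    the unlinked ones \<open>Q\<close> and \<open>P\<close> agree, so adding the linked realisations
    of \<open>P\<close> finishes the count.\<close>
  have "card {u \<in> extensions A v E. Q A u \<and> (\<forall>i \<in> E. \<not> linked r D E A u i)} =
      card {u \<in> extensions B w E. Q B u \<and> (\<forall>i \<in> E. \<not> linked r D E B u i)}"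
    using total linked_any[OF sphere_invariant_mono[OF QE]] split[OF finA, of v "Q A"] split[OF finB, of w "Q B"]
    by simp
  then show ?case
    using linked_any[OF Suc.prems(5)] split[OF finA, of v "P A"] split[OF finB, of w "P B"] PQ by simp
qed

section \<open>Truth of quantifier blocks and of formulas in \<open>BSigma\<close>\<close>

text \<open>Only the set of quantified variables matters: if a variable is repeated, the inner
  quantifier overwrites it and the outer one is vacuous over a non-empty universe.\<close>

lemma sat_ex_block:
  assumes "fst A \<noteq> {}"
  shows "sat A v (ex_block xs g) \<longleftrightarrow> (\<exists>u \<in> extensions A v (set xs). sat A u g)"
proof (induction xs arbitrary: v)
  case Nil
  then show ?case by (simp add: ex_block_def extensions_empty)
next
  case (Cons x xs)
  have "extensions A v (set (x # xs)) = (\<Union>a \<in> fst A. extensions A (v(x := a)) (set xs))"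
  proof (cases "x \<in> set xs")
    case True
    then have "extensions A (v(x := a)) (set xs) = extensions A v (set xs)" for a
      by (auto simp: extensions_def)
    then show ?thesis using True assms by (simp add: insert_absorb)
  next
    case False
    then show ?thesis using extensions_insert by simp
  qed
  then show ?case using Cons by (simp add: ex_block_def del: fun_upd_apply)
qed

lemma free_vars_ex_block: "free_vars (ex_block xs g) = free_vars g - set xs"
  by (induction xs) (auto simp: ex_block_def)

text \<open>The counted property is having the same \<open>r\<close>-sphere as the witness
  \<open>u\<close>. Its count in \<open>A\<close> is positive because of \<open>u\<close>, hence so
  is the count in \<open>B\<close>, and any realisation there is a witness. The block overwrites its
  variables, so they are removed from \<open>D\<close>.\<close>

lemma sat_ex_block_transfer:
  fixes D :: "nat set"
  assumes A: "is_struc ar A" and B: "is_struc ar B" and f: "hanf_bij ar R A B f"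
    and R: "(2 * r + 1) * length xs + r \<le> R"
    and iso: "local_iso ar ((2 * r + 1) * length xs + r) D A v B w"
    and g: "\<And>u u'. local_iso ar r (D - set xs \<union> set xs) A u B u' \<Longrightarrow> sat A u g \<Longrightarrow> sat B u' g"
    and s: "sat A v (ex_block xs g)"
  shows "sat B w (ex_block xs g)"
proof -
  have ne: "fst A \<noteq> {}" "fst B \<noteq> {}" and fin: "finite (fst A)" using A B unfolding is_struc_def by blast+
  let ?E = "set xs" and ?D = "D - set xs"
  obtain u where u: "u \<in> extensions A v ?E" "sat A u g" using s sat_ex_block[OF ne(1)] by blast
  define P where "P S u' = local_iso ar r (?D \<union> ?E) A u S u'" for S u'
  \<comment> \<open>Repeated variables make the set smaller than the list.\<close>
  have len: "(2 * r + 1) * card ?E + r \<le> (2 * r + 1) * length xs + r"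
    using card_length[of xs] by (intro add_mono mult_le_mono) auto
  have "v ` D \<subseteq> fst A" using iso local_iso_byD(3) unfolding local_iso_def by blast
  then have uA: "u ` (?D \<union> ?E) \<subseteq> fst A" using u(1) by (auto simp: extensions_def)
  have "card {u \<in> extensions A v ?E. P A u} = card {u \<in> extensions B w ?E. P B u}"
  proof (rule card_extensions_eq[OF A B f])
    show "(2 * r + 1) * card ?E + r \<le> R" using len R by simp
    show "local_iso ar ((2 * r + 1) * card ?E + r) ?D A v B w"
      using iso len by (rule local_iso_mono) auto
    show "sphere_invariant ar r (?D \<union> ?E) P"
      unfolding sphere_invariant_def P_def using local_iso_trans local_iso_sym by blast
  qed auto
  moreover have "u \<in> {u \<in> extensions A v ?E. P A u}"
    using u(1) local_iso_refl[OF A uA] unfolding P_def by blast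
  then have "card {u \<in> extensions A v ?E. P A u} \<noteq> 0"
    using finite_extensions[OF _ fin, of ?E v] by auto
  ultimately have "{u \<in> extensions B w ?E. P B u} \<noteq> {}" by (metis card.empty)
  then obtain u' where "u' \<in> extensions B w ?E" "P B u'" by blast
  then show ?thesis using g[of u u'] u(2) sat_ex_block[OF ne(2)] unfolding P_def by blast
qed

fun hanf_radius :: "nat \<Rightarrow> nat \<Rightarrow> nat" where
  "hanf_radius l 0 = 0"
| "hanf_radius l (Suc n) = (2 * hanf_radius l n + 1) * l + hanf_radius l n"

text \<open>Each level multiplies \<open>2 * hanf_radius l n + 1\<close> by
  \<open>2 * l + 1\<close>, starting from 1.\<close>

lemma hanf_radius_less: "hanf_radius l n < (2 * l + 1) ^ n"
proof -
  have "2 * hanf_radius l n + 1 = (2 * l + 1) ^ n"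
    by (induction n) (auto simp: algebra_simps)
  then show ?thesis by linarith
qed

text \<open>At radius 0 the sphere consists of the named points; injectivity of \<open>h\<close>
  handles equality and preservation of tuples handles relations.\<close>

lemma sat_qfree:
  assumes h: "local_iso_by h ar 0 D A v B w"
  shows "qfree \<phi> \<Longrightarrow> free_vars \<phi> \<subseteq> D \<Longrightarrow> sat A v \<phi> \<longleftrightarrow> sat B w \<phi>"
proof (induction \<phi>)
  case (Eq x y)
  have "v x \<in> ball_of A 0 (v ` D)" "v y \<in> ball_of A 0 (v ` D)"
    using Eq subset_ball_of[OF local_iso_byD(3)[OF h], of 0] by auto
  then have "v x = v y \<longleftrightarrow> h (v x) = h (v y)"
    using inj_on_eq_iff[OF bij_betw_imp_inj_on[OF local_iso_byD(5)[OF h]]] by simp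
  then show ?case using Eq local_iso_byD(6)[OF h] by simp
next
  case (Rel R vs)
  have "set (map v vs) \<subseteq> ball_of A 0 (v ` D)"
    using Rel subset_ball_of[OF local_iso_byD(3)[OF h], of 0] by auto
  moreover have "map h (map v vs) = map w vs" using Rel local_iso_byD(6)[OF h] by auto
  ultimately show ?case using local_iso_byD(7)[OF h, of "map v vs" R] by (simp del: map_map)
qed auto

text \<open>Induction on \<open>n\<close>, and inside it on the Boolean combination. The bijection
  keeps its radius \<open>R\<close> throughout, while the local isomorphism loses radius with every
  block.\<close>

lemma sat_BSigma:
  assumes A: "is_struc ar A" and B: "is_struc ar B" and f: "hanf_bij ar R A B f"
  shows "\<phi> \<in> BSigma n l \<Longrightarrow> hanf_radius l n \<le> R \<Longrightarrow> free_vars \<phi> \<subseteq> D \<Longrightarrow>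
    local_iso ar (hanf_radius l n) D A v B w \<Longrightarrow> sat A v \<phi> \<longleftrightarrow> sat B w \<phi>"
proof (induction n arbitrary: \<phi> D v w)
  case 0
  then show ?case using sat_qfree unfolding local_iso_def by fastforce
next
  case (Suc n)
  let ?r = "hanf_radius l n"
  note iso = Suc.prems(4)
  have "\<phi> \<in> bool_comb {ex_block xs g | xs g. length xs \<le> l \<and> g \<in> BSigma n l}" using Suc.prems(1) by simp
  then show ?case using Suc.prems(3)
  proof (induction rule: bool_comb.induct)
    case (base \<phi>)
    then obtain xs g where \<phi>: "\<phi> = ex_block xs g" "length xs \<le> l" "g \<in> BSigma n l" by blast
    have len: "(2 * ?r + 1) * length xs + ?r \<le> hanf_radius l (Suc n)"
      unfolding hanf_radius.simps by (intro add_mono mult_le_mono order.refl \<phi>(2))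
    have fv: "free_vars g \<subseteq> D - set xs \<union> set xs" using base.prems \<phi>(1) free_vars_ex_block by fastforce
    have rR: "?r \<le> R" "(2 * ?r + 1) * length xs + ?r \<le> R" using len Suc.prems(2) by auto
    have iso': "local_iso ar ((2 * ?r + 1) * length xs + ?r) D A v B w"
      using iso len by (rule local_iso_mono) auto
    have eq: "sat A u g \<longleftrightarrow> sat B u' g" if "local_iso ar ?r (D - set xs \<union> set xs) A u B u'" for u u'
      using Suc.IH[OF \<phi>(3) rR(1) fv that] .
    show ?case unfolding \<phi>(1)
    proof
      assume "sat A v (ex_block xs g)"
      then show "sat B w (ex_block xs g)"
        using sat_ex_block_transfer[OF A B f rR(2) iso'] eq by blast
    next
      \<comment> \<open>The converse is the same transfer with the structures exchanged and the
        bijection inverted.\<close>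
      assume "sat B w (ex_block xs g)"
      then show "sat A v (ex_block xs g)"
        using sat_ex_block_transfer[OF B A hanf_bij_sym[OF f] rR(2) local_iso_sym[OF iso']]
          eq[OF local_iso_sym] by blast
    qed
  qed auto
qed

section \<open>From equivalence of structures to Hanf locality\<close>

lemma sphere_iso_local_iso:
  assumes A: "is_struc ar A" and B: "is_struc ar B" and sub: "set as \<subseteq> fst A" "set bs \<subseteq> fst B"
    and s: "sphere_iso A as B bs r"
  shows "local_iso ar r {..<length as} A (nth as) B (nth bs)"
proof -
  obtain h where h: "length as = length bs" "bij_betw h (nbhd A r as) (nbhd B r bs)" "map h as = bs"
    "\<forall>R t. set t \<subseteq> nbhd A r as \<longrightarrow> (t \<in> snd A R \<longleftrightarrow> map h t \<in> snd B R)"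
    using s unfolding sphere_iso_def by blast
  have im: "nth as ` {..<length as} = set as" "nth bs ` {..<length as} = set bs"
    using h(1) by (auto simp: set_conv_nth)
  have "local_iso_by h ar r {..<length as} A (nth as) B (nth bs)"
    unfolding local_iso_by_def im using A B sub h by (auto simp: nbhd_eq_ball_of)
  then show ?thesis unfolding local_iso_def by blast
qed

lemma assign_nth:
  assumes "distinct xs" "length as = length xs" "i < length xs"
  shows "assign xs as (xs ! i) = as ! i"
  using assms map_of_zip_nth[of xs as i] unfolding assign_def by simp

lemma hanf_local_with_BSigma:
  assumes "distinct xs" "free_vars \<phi> \<subseteq> set xs" "\<phi> \<in> BSigma n l"
  shows "hanf_local_with ar xs \<phi> (hanf_radius l n)"
  unfolding hanf_local_with_def
proof (intro allI impI, elim conjE)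
  fix A B as bs
  assume A: "is_struc ar A" and B: "is_struc ar B" and len: "length as = length xs" "length bs = length xs"
    and sub: "set as \<subseteq> fst A" "set bs \<subseteq> fst B" and "r_equiv A as B bs (hanf_radius l n)"
  let ?r = "hanf_radius l n"
  obtain f where f: "bij_betw f (fst A) (fst B)"
    and s: "\<And>c. c \<in> fst A \<Longrightarrow> sphere_iso A (as @ [c]) B (bs @ [f c]) ?r"
    using \<open>r_equiv A as B bs ?r\<close> unfolding r_equiv_def by blast
  \<comment> \<open>Index \<open>length xs\<close> is the position of the appended element, hence
    the closed bound. Restricting to that index yields the bijection condition, restricting to the
    others the valuation of \<open>xs\<close>.\<close>
  have iso: "local_iso ar ?r {..length xs} A (nth (as @ [c])) B (nth (bs @ [f c]))" if c: "c \<in> fst A" for c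
    using sphere_iso_local_iso[OF A B _ _ s[OF c]] sub c f len bij_betwE[OF f] by (simp add: lessThan_Suc_atMost)
  have "local_iso ar ?r {()} A (\<lambda>_. c) B (\<lambda>_. f c)" if c: "c \<in> fst A" for c
    by (rule local_iso_mono[OF iso[OF c] order.refl]) (use len in \<open>auto intro!: bexI[of _ "length xs"] simp: nth_append\<close>)
  then have hb: "hanf_bij ar ?r A B f" using f unfolding hanf_bij_def by blast
  \<comment> \<open>Any element serves, as its position is dropped again.\<close>
  obtain c where c: "c \<in> fst A" using A unfolding is_struc_def by blast
  have "local_iso ar ?r (set xs) A (assign xs as) B (assign xs bs)"
  proof (rule local_iso_mono[OF iso[OF c] order.refl])
    fix x assume "x \<in> set xs"
    then obtain i where "i < length xs" "x = xs ! i" by (metis in_set_conv_nth)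
    then show "\<exists>y \<in> {..length xs}. assign xs as x = (as @ [c]) ! y \<and> assign xs bs x = (bs @ [f c]) ! y"
      using assms(1) len by (intro bexI[of _ i]) (auto simp: assign_nth nth_append)
  qed
  then show "sat A (assign xs as) \<phi> \<longleftrightarrow> sat B (assign xs bs) \<phi>"
    using sat_BSigma[OF A B hb assms(3) order.refl assms(2)] by blast
qed

section \<open>Formula length and the size of quantifier blocks\<close>

lemma fo_len_pos: "0 < fo_len \<phi>"
  by (cases \<phi>) auto

lemma fo_len_ex_block: "fo_len (ex_block xs g) = 2 * length xs + fo_len g"
  by (induction xs) (auto simp: ex_block_def)

text \<open>A block of \<open>k\<close> quantifiers has length at least \<open>2 * k + 1\<close>,
  two symbols for each quantifier and one for its body. Length at most \<open>2 * m + 2\<close>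
  therefore forces \<open>k \<le> m\<close>, and subformulas inherit the bound.\<close>

lemma BSigma_fo_len: "\<phi> \<in> BSigma n l \<Longrightarrow> fo_len \<phi> \<le> 2 * m + 2 \<Longrightarrow> \<phi> \<in> BSigma n m"
proof (induction n arbitrary: \<phi>)
  case 0
  then show ?case by simp
next
  case (Suc n)
  have "\<phi> \<in> bool_comb {ex_block xs g | xs g. length xs \<le> l \<and> g \<in> BSigma n l}" using Suc.prems(1) by simp
  then have "\<phi> \<in> bool_comb {ex_block xs g | xs g. length xs \<le> m \<and> g \<in> BSigma n m}" using Suc.prems(2)
  proof (induction rule: bool_comb.induct)
    case (base \<phi>)
    then obtain xs g where \<phi>: "\<phi> = ex_block xs g" "g \<in> BSigma n l" by blast
    then have "2 * length xs + fo_len g \<le> 2 * m + 2" using base.prems fo_len_ex_block by metis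
    then have "length xs \<le> m" "fo_len g \<le> 2 * m + 2" using fo_len_pos[of g] by linarith+
    then show ?case using \<phi> Suc.IH by (blast intro: bool_comb.base)
  qed (auto intro: bool_comb.intros)
  then show ?case by simp
qed

theorem theorem5p6:
  fixes ar :: "'r \<Rightarrow> nat" and xs :: "nat list" and \<phi> :: "'r fo" and n l :: nat
  assumes "wf_fo ar \<phi>"
    and "distinct xs" and "xs \<noteq> []" and "free_vars \<phi> \<subseteq> set xs"
    and "\<phi> \<in> BSigma n l"
  shows "hanf_local ar xs \<phi> \<and> locality_rank ar xs \<phi> < (2 * l + 1) ^ n \<and>
         ((\<forall>l' < l. \<phi> \<notin> BSigma n l') \<longrightarrow> (2 * l + 1) ^ n \<le> fo_len \<phi> ^ n)"
proof (intro conjI impI)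
  have hl: "hanf_local_with ar xs \<phi> (hanf_radius l n)"
    using hanf_local_with_BSigma assms by blast
  then show "hanf_local ar xs \<phi>" unfolding hanf_local_def by blast
  have "locality_rank ar xs \<phi> \<le> hanf_radius l n"
    unfolding locality_rank_def using hl by (rule Least_le)
  then show "locality_rank ar xs \<phi> < (2 * l + 1) ^ n" using hanf_radius_less le_less_trans by blast
  \<comment> \<open>\<open>BSigma n l\<close> grows with \<open>l\<close>, so the length can be
    compared only with the least admissible \<open>l\<close>. A formula of length at most
    \<open>2 * l\<close> would have only blocks of at most \<open>l - 1\<close> quantifiers, against
    minimality.\<close>
  assume min: "\<forall>l' < l. \<phi> \<notin> BSigma n l'"
  have "2 * l + 1 \<le> fo_len \<phi>"
  proof (rule ccontr)
    assume short: "\<not> ?thesis"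
    then have "0 < l" using fo_len_pos[of \<phi>] by linarith
    moreover have "fo_len \<phi> \<le> 2 * (l - 1) + 2" using short by linarith
    then have "\<phi> \<in> BSigma n (l - 1)" using BSigma_fo_len assms(5) by blast
    ultimately show False using min by simp
  qed
  then show "(2 * l + 1) ^ n \<le> fo_len \<phi> ^ n" by (rule power_mono) simp
qed

end
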